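(* Let $G$ be a mixed graph on $n$ vertices, and let $\boldsymbol{\xi}_1(G)\ge\cdots\ge\boldsymbol{\xi}_{2n}(G)$ be the eigenvalues of its integrated signless Laplacian matrix. Then $\boldsymbol{\xi}_{2n}(G)\leq\frac{4}{n}(e(G)+l(G))\leq\boldsymbol{\xi}_2(G)$ and $\boldsymbol{\xi}_{2n-1}(G)\leq\frac{2}{n}(2e(G)+2l(G)+a(G))\leq\boldsymbol{\xi}_1(G)$.
   Context: A mixed graph $G=(V_G,E_G,\vec{E}_G)$ has a finite vertex set, a multiset $E_G$ of unordered pairs (edges; $\{v,v\}$ is a loop) and a multiset $\vec{E}_G$ of ordered pairs (arcs; $(v,v)$ is a directed loop). $d(v)$ is the number of edges at $v$, loops counted twice; $d^+(v)$ (resp. $d^-(v)$) the number of arcs starting (resp. ending) at $v$, directed loops included. $e(G)$ is the number of edges excluding loops, $l(G)$ the number of loops, $a(G)$ the number of arcs including directed loops. For $V_G=\{v_1,\dots,v_n\}$, the integrated adjacency matrix $\mathcal{I}(G)$ is the $2n\times 2n$ matrix indexed by $v'_1,\dots,v'_n,v''_1,\dots,v''_n$ whose $(v'_i,v'_j)$ and $(v''_i,v''_j)$ entries are the number of edges joining $v_i,v_j$ if $i\neq j$ and $2\times$(number of loops at $v_i$) if $i=j$, and whose $(v'_i,v''_j)$ and $(v''_j,v'_i)$ entries are the number of arcs from $v_i$ to $v_j$. The integrated degree matrix $\mathcal{I}^D(G)$ is diagonal with $(v'_i,v'_i)$ entry $d(v_i)+d^+(v_i)$ and $(v''_i,v''_i)$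 entry $d(v_i)+d^-(v_i)$; the integrated signless Laplacian matrix is $\mathcal{I}^Q(G)=\mathcal{I}^D(G)+\mathcal{I}(G)$. *)

theory Defs
  imports
    "HOL-Library.Uprod"
    "HOL-Computational_Algebra.Fundamental_Theorem_Algebra"
    "Jordan_Normal_Form.Char_Poly"
begin

record 'a mixed_graph =
  verts :: "'a set"
  edges :: "'a uprod multiset"
  arcs :: "('a \<times> 'a) multiset"

definition wf_mixed_graph :: "'a mixed_graph \<Rightarrow> bool" where
  "wf_mixed_graph G \<longleftrightarrow>
     finite (verts G) \<and>
     (\<forall>e \<in># edges G. set_uprod e \<subseteq> verts G) \<and>
     (\<forall>(u, v) \<in># arcs G. u \<in> verts G \<and> v \<in> verts G)"

definition num_edges :: "'a mixed_graph \<Rightarrow> nat" where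
  "num_edges G = size {#e \<in># edges G. proper_uprod e#}"

definition num_loops :: "'a mixed_graph \<Rightarrow> nat" where
  "num_loops G = size {#e \<in># edges G. \<not> proper_uprod e#}"

definition num_arcs :: "'a mixed_graph \<Rightarrow> nat" where
  "num_arcs G = size (arcs G)"

text \<open>The first summand counts every edge and loop at \<open>v\<close> once; the second counts
  the loops at \<open>v\<close> once more.\<close>

definition deg :: "'a mixed_graph \<Rightarrow> 'a \<Rightarrow> nat" where
  "deg G v = size {#e \<in># edges G. v \<in> set_uprod e#} + count (edges G) (Upair v v)"

definition out_deg :: "'a mixed_graph \<Rightarrow> 'a \<Rightarrow> nat" where
  "out_deg G v = size {#a \<in># arcs G. fst a = v#}"

definition in_deg :: "'a mixed_graph \<Rightarrow> 'a \<Rightarrow> nat" where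
  "in_deg G v = size {#a \<in># arcs G. snd a = v#}"

text \<open>The matrices below are taken with respect to an enumeration \<open>vs\<close> of the vertices, a
  distinct list with \<open>set vs = verts G\<close>. With \<open>n = length vs\<close>, the row and column indices
  \<open>i\<close> and \<open>n + i\<close>, for \<open>i < n\<close>, stand for the two copies of the vertex \<open>vs ! i\<close>.\<close>

definition edge_matrix :: "'a mixed_graph \<Rightarrow> 'a list \<Rightarrow> real mat" where
  "edge_matrix G vs = mat (length vs) (length vs) (\<lambda>(i, j).
     if i = j then 2 * real (count (edges G) (Upair (vs ! i) (vs ! i)))
     else real (count (edges G) (Upair (vs ! i) (vs ! j))))"

definition arc_matrix :: "'a mixed_graph \<Rightarrow> 'a list \<Rightarrow> real mat" where
  "arc_matrix G vs = mat (length vs) (length vs) (\<lambda>(i, j).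
     real (count (arcs G) (vs ! i, vs ! j)))"

definition integrated_adjacency :: "'a mixed_graph \<Rightarrow> 'a list \<Rightarrow> real mat" where
  "integrated_adjacency G vs =
     four_block_mat (edge_matrix G vs) (arc_matrix G vs)
                    (transpose_mat (arc_matrix G vs)) (edge_matrix G vs)"

definition integrated_degree :: "'a mixed_graph \<Rightarrow> 'a list \<Rightarrow> real mat" where
  "integrated_degree G vs = (let n = length vs in
     four_block_mat
       (mat_diag n (\<lambda>i. real (deg G (vs ! i) + out_deg G (vs ! i))))
       (0\<^sub>m n n) (0\<^sub>m n n)
       (mat_diag n (\<lambda>i. real (deg G (vs ! i) + in_deg G (vs ! i)))))"

definition integrated_signless_laplacian :: "'a mixed_graph \<Rightarrow> 'a list \<Rightarrow> real mat" where
  "integrated_signless_laplacian G vs = integrated_degree G vs + integrated_adjacency G vs"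

text \<open>The real eigenvalues with their algebraic multiplicities, in decreasing order;
  \<open>eigval A k\<close> is the \<open>k\<close>-th largest one, counting from \<open>k = 1\<close>. By
  \<open>length_eigvals_desc\<close> below, a symmetric matrix of size \<open>m\<close> has exactly \<open>m\<close> of them.\<close>

definition eigvals_desc :: "real mat \<Rightarrow> real list" where
  "eigvals_desc A = rev (sorted_list_of_multiset (proots (char_poly A)))"

definition eigval :: "real mat \<Rightarrow> nat \<Rightarrow> real" where
  "eigval A k = eigvals_desc A ! (k - 1)"

lemma symmetric_real_eigenvalue:
  fixes A :: "real mat" and a :: complex
  assumes A: "A \<in> carrier_mat m m" and sym: "transpose_mat A = A"
    and ev: "eigenvalue (map_mat of_real A) a"
  shows "a \<in> \<real>"
proof -
  let ?A = "map_mat complex_of_real A"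
  from ev A obtain v where v: "v \<in> carrier_vec m" "v \<noteq> 0\<^sub>v m" "?A *\<^sub>v v = a \<cdot>\<^sub>v v"
    unfolding eigenvalue_def eigenvector_def by auto
  have symm: "A $$ (j, i) = A $$ (i, j)" if "i < m" "j < m" for i j
    using that A arg_cong[OF sym, of "\<lambda>B. B $$ (i, j)"] by simp
  have row: "(\<Sum>j<m. of_real (A $$ (i, j)) * v $ j) = a * v $ i" if "i < m" for i
    using arg_cong[OF v(3), of "\<lambda>w. w $ i"] that A v(1)
    by (simp add: scalar_prod_def atLeast0LessThan)
  define S where "S = (\<Sum>i<m. \<Sum>j<m. cnj (v $ i) * (of_real (A $$ (i, j)) * v $ j))"
  define N where "N = (\<Sum>i<m. (cmod (v $ i))\<^sup>2)"
  have S: "S = a * of_real N"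
  proof -
    have "(\<Sum>j<m. cnj (v $ i) * (of_real (A $$ (i, j)) * v $ j)) =
        a * of_real ((cmod (v $ i))\<^sup>2)" if "i < m" for i
      unfolding sum_distrib_left[symmetric] row[OF that] complex_norm_square by simp
    then show ?thesis unfolding S_def N_def by (simp add: sum_distrib_left)
  qed
  have "cnj S = (\<Sum>i<m. \<Sum>j<m. cnj (v $ j) * (of_real (A $$ (j, i)) * v $ i))"
    unfolding S_def by (simp add: symm algebra_simps)
  also have "\<dots> = S" unfolding S_def by (rule sum.swap)
  finally have "cnj a * of_real N = a * of_real N" using S by simp
  moreover obtain i where "i < m" "v $ i \<noteq> 0"
    using v(1,2) by (metis carrier_vecD eq_vecI index_zero_vec)
  then have "N > 0" unfolding N_def by (intro sum_pos2[of _ i]) auto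
  ultimately show ?thesis by (simp add: Reals_cnj_iff)
qed

lemma length_eigvals_desc:
  assumes A: "A \<in> carrier_mat m m" and sym: "transpose_mat A = A"
  shows "length (eigvals_desc A) = m"
proof -
  let ?A = "map_mat complex_of_real A"
  have A': "?A \<in> carrier_mat m m" using A by simp
  obtain as where as: "char_poly ?A = (\<Prod>a\<leftarrow>as. [:- a, 1:])" "length as = m"
    using char_poly_factorized[OF A'] by blast
  have "a \<in> \<real>" if "a \<in> set as" for a
  proof -
    have "poly (char_poly ?A) a = 0"
      unfolding as(1) using that by (induction as) auto
    then show ?thesis
      using symmetric_real_eigenvalue[OF A sym] eigenvalue_root_char_poly[OF A'] by blast
  qed
  then have bs: "as = map (\<lambda>a. complex_of_real (Re a)) as"
    by (induction as) auto
  interpret h: map_poly_inj_idom_hom complex_of_real ..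
  have "map_poly complex_of_real (char_poly A) = char_poly ?A"
    by (simp add: of_real_hom.char_poly_hom[OF A])
  also have "\<dots> = map_poly complex_of_real (\<Prod>a\<leftarrow>as. [:- Re a, 1:])"
    unfolding as(1) by (subst bs) (simp add: h.hom_prod_list o_def)
  finally have "char_poly A = (\<Prod>a\<leftarrow>as. [:- Re a, 1:])" by simp
  moreover have "size (proots (\<Prod>a\<leftarrow>as. [:- Re a, 1:])) = length as"
  proof (induction as)
    case (Cons a as)
    have "(\<Prod>a\<leftarrow>as. [:- Re a, 1:]) \<noteq> 0" by auto
    then have "proots ([:- Re a, 1:] * (\<Prod>a\<leftarrow>as. [:- Re a, 1:])) =
        {#Re a#} + proots (\<Prod>a\<leftarrow>as. [:- Re a, 1:])"
      by (subst proots_mult) auto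
    with Cons show ?case by (simp del: mult_pCons_left)
  qed simp
  ultimately show ?thesis unfolding eigvals_desc_def using as(2)
    by (metis length_rev mset_sorted_list_of_multiset size_mset)
qed

lemma integrated_signless_laplacian_carrier:
  "integrated_signless_laplacian G vs \<in> carrier_mat (2 * length vs) (2 * length vs)"
  unfolding integrated_signless_laplacian_def integrated_degree_def integrated_adjacency_def
    edge_matrix_def arc_matrix_def mat_diag_def Let_def carrier_mat_def by simp

lemma transpose_integrated_signless_laplacian:
  "transpose_mat (integrated_signless_laplacian G vs) = integrated_signless_laplacian G vs"
  unfolding integrated_signless_laplacian_def integrated_degree_def integrated_adjacency_def
    edge_matrix_def arc_matrix_def mat_diag_def Let_def
  by (rule eq_matI) (auto intro!: arg_cong[where f = "count (edges G)"])

end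

theory Submission
  imports Defs
begin

text \<open>Take the vectors that are equal to \<open>p\<close> on the first copy of the vertex set and to \<open>q\<close> on
  the second. On this plane the quadratic form of the integrated signless Laplacian is
  \<open>4 (e + l) (p\<^sup>2 + q\<^sup>2) + a (p + q)\<^sup>2\<close>, while the squared norm is \<open>n (p\<^sup>2 + q\<^sup>2)\<close>. The Rayleigh
  quotient there thus ranges over the interval from \<open>4 (e + l) / n\<close> (at \<open>q = - p\<close>) to
  \<open>(4 (e + l) + 2 a) / n\<close> (at \<open>q = p\<close>). The extreme eigenvalues bound all Rayleigh quotients;
  and the plane contains a nonzero vector orthogonal to an eigenvector of any prescribed
  eigenvalue, which gives the bounds on the second largest and second smallest ones.\<close>

section \<open>Splitting of the characteristic polynomial and order of its roots\<close>

text \<open>The assumption says that \<open>p\<close> has as many roots, with multiplicity, as its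
  degree allows. Splitting off one linear factor lowers both numbers by one and keeps the leading
  coefficient, so induction on the degree applies.\<close>

lemma poly_eq_prod_proots:
  fixes p :: "'a :: field poly"
  assumes "size (proots p) = degree p"
  shows "p = Polynomial.smult (lead_coeff p) (\<Prod>a\<in>#proots p. [:- a, 1:])"
  using assms
proof (induction "degree p" arbitrary: p)
  case 0
  then obtain c where "p = [:c:]" by (metis degree_eq_zeroE)
  then show ?case by simp
next
  case (Suc d)
  then obtain a where a: "a \<in># proots p"
    by (metis nat.distinct(1) size_eq_Suc_imp_elem)
  have "p \<noteq> 0" using Suc.hyps by auto
  with a have "poly p a = 0" by simp
  then obtain q where q: "p = [:- a, 1:] * q" using poly_eq_0_iff_dvd by (metis dvdE)
  with \<open>p \<noteq> 0\<close> have "q \<noteq> 0" by auto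
  then have pr: "proots p = {#a#} + proots q" and deg: "degree p = Suc (degree q)"
    unfolding q by (subst proots_mult, auto simp del: mult_pCons_left) (subst degree_mult_eq, auto)
  with Suc have IH: "Polynomial.smult (lead_coeff q) (\<Prod>a\<in>#proots q. [:- a, 1:]) = q" by simp
  have lc: "lead_coeff p = lead_coeff q" unfolding q by (subst lead_coeff_mult) simp
  have "Polynomial.smult (lead_coeff p) (\<Prod>a\<in>#proots p. [:- a, 1:]) =
      [:- a, 1:] * Polynomial.smult (lead_coeff q) (\<Prod>a\<in>#proots q. [:- a, 1:])"
    unfolding pr lc by (simp del: mult_pCons_left)
  then show ?case unfolding IH using q by simp
qed

text \<open>By symmetry there are \<open>m\<close> real roots, as many as the degree, and the
  polynomial is monic. Listing the factors in decreasing order fixes the order of the diagonal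
  entries in the diagonalization below.\<close>

lemma char_poly_eigvals_desc:
  assumes A: "A \<in> carrier_mat m m" and sym: "transpose_mat A = A"
  shows "char_poly A = (\<Prod>e\<leftarrow>eigvals_desc A. [:- e, 1:])"
proof -
  have mset: "mset (eigvals_desc A) = proots (char_poly A)"
    unfolding eigvals_desc_def by simp
  have "size (proots (char_poly A)) = degree (char_poly A)"
    using length_eigvals_desc[OF A sym] degree_monic_char_poly[OF A] mset by (metis size_mset)
  from poly_eq_prod_proots[OF this] show ?thesis
    using degree_monic_char_poly[OF A]
    by (simp add: mset[symmetric] prod_mset_prod_list flip: mset_map)
qed

lemma eigvals_desc_mono:
  assumes "i \<le> j" "j < length (eigvals_desc A)"
  shows "eigvals_desc A ! j \<le> eigvals_desc A ! i"
  using assms unfolding eigvals_desc_def by (auto simp: rev_nth intro!: sorted_nth_mono)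

section \<open>Orthogonal diagonalization of real symmetric matrices\<close>

text \<open>The Householder reflection exchanging \<open>v\<close> and the first unit vector; for \<open>w = 0\<close> the
  junk value \<open>2 / 0 = 0\<close> turns it into the identity, as it should.\<close>

lemma ex_householder:
  fixes v :: "real vec"
  assumes v: "v \<in> carrier_vec n" and n: "0 < n" and unit: "v \<bullet> v = 1"
  obtains H where "H \<in> carrier_mat n n" "transpose_mat H = H" "H * H = 1\<^sub>m n" "col H 0 = v"
proof -
  define w where "w i = (if i = 0 then 1 else 0) - v $ i" for i
  define s where "s = (\<Sum>i<n. (w i)\<^sup>2)"
  define c where "c = 2 / s"
  define H where "H = mat n n (\<lambda>(i, j). (if i = j then 1 else 0) - c * w i * w j)"
  have H: "H \<in> carrier_mat n n" unfolding H_def by simp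
  have sym: "transpose_mat H = H" unfolding H_def by (rule eq_matI) auto
  \<comment> \<open>This makes the terms of \<open>H * H\<close> that involve \<open>w\<close>
    cancel. It also holds for \<open>s = 0\<close>, since then \<open>c = 0\<close>.\<close>
  have cs: "c * c * s = 2 * c" unfolding c_def by simp
  have HH: "H * H = 1\<^sub>m n"
  proof (rule eq_matI)
    fix i j assume "i < dim_row (1\<^sub>m n :: real mat)" "j < dim_col (1\<^sub>m n :: real mat)"
    then have ij: "i < n" "j < n" by auto
    have "(H * H) $$ (i, j) = (\<Sum>k<n. ((if i = k then 1 else 0) - c * w i * w k) *
        ((if k = j then 1 else 0) - c * w k * w j))"
      using ij unfolding H_def by (simp add: scalar_prod_def atLeast0LessThan)
    also have "\<dots> = (\<Sum>k<n. (if i = k then (if i = j then 1 else 0) - c * w i * w j else 0)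
        - (if k = j then c * w i * w j else 0) + c * c * w i * w j * (w k)\<^sup>2)"
      by (intro sum.cong refl) (auto simp: algebra_simps power2_eq_square)
    also have "\<dots> = (if i = j then 1 else 0) - 2 * c * w i * w j + c * c * s * w i * w j"
      using ij unfolding s_def
      by (simp add: sum.distrib sum_subtractf flip: sum_distrib_left)
    also have "\<dots> = 1\<^sub>m n $$ (i, j)" using ij unfolding cs by simp
    finally show "(H * H) $$ (i, j) = 1\<^sub>m n $$ (i, j)" .
  qed (use H in auto)
  have vv: "(\<Sum>i<n. (v $ i)\<^sup>2) = 1"
    using unit v by (simp add: scalar_prod_def atLeast0LessThan power2_eq_square)
  \<comment> \<open>The squared distance of two unit vectors is 2 minus twice their scalar product,
    which here is \<open>v $ 0\<close>.\<close>
  have "s = (\<Sum>i<n. (if i = 0 then 1 - 2 * v $ 0 else 0) + (v $ i)\<^sup>2)"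
    unfolding s_def w_def by (intro sum.cong refl) (auto simp: power2_eq_square algebra_simps)
  also have "\<dots> = 2 * w 0" using n vv by (simp add: sum.distrib w_def)
  finally have s: "s = 2 * w 0" .
  have "col H 0 = v"
  proof (rule eq_vecI)
    fix i assume "i < dim_vec v"
    then have i: "i < n" using v by simp
    \<comment> \<open>Column 0 of \<open>H\<close> is the first unit vector minus
      \<open>c * w 0\<close> times \<open>w\<close>, whereas \<open>v\<close> is the first unit
      vector minus \<open>w\<close>. They agree because either \<open>w\<close> vanishes or
      \<open>c * w 0 = 1\<close>.\<close>
    have "c * w i * w 0 = w i"
    proof (cases "s = 0")
      case True
      then have "w i = 0" using i unfolding s_def by (simp add: sum_nonneg_eq_0_iff)
      then show ?thesis by simp
    next
      case False
      then show ?thesis unfolding c_def s by simp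
    qed
    moreover have "col H 0 $ i = (if i = 0 then 1 else 0) - c * w i * w 0"
      using i n unfolding H_def by simp
    ultimately have "col H 0 $ i = (if i = 0 then 1 else 0) - w i" by linarith
    then show "col H 0 $ i = v $ i" by (simp add: w_def)
  qed (use v H in auto)
  with that H sym HH show ?thesis by blast
qed

lemma ex_unit_eigenvector:
  fixes A :: "real mat"
  assumes A: "A \<in> carrier_mat n n" and e: "poly (char_poly A) e = 0"
  obtains v where "v \<in> carrier_vec n" "v \<bullet> v = 1" "A *\<^sub>v v = e \<cdot>\<^sub>v v"
proof -
  from e eigenvalue_root_char_poly[OF A] obtain u where
    u: "u \<in> carrier_vec n" "u \<noteq> 0\<^sub>v n" "A *\<^sub>v u = e \<cdot>\<^sub>v u"
    using A unfolding eigenvalue_def eigenvector_def by auto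
  have "u \<bullet> u = (\<Sum>i<n. (u $ i)\<^sup>2)"
    using u(1) by (simp add: scalar_prod_def atLeast0LessThan power2_eq_square)
  moreover obtain i where "i < n" "u $ i \<noteq> 0"
    using u(1,2) by (metis carrier_vecD eq_vecI index_zero_vec)
  ultimately have pos: "u \<bullet> u > 0" by (auto intro: sum_pos2[of _ i])
  define c where "c = 1 / sqrt (u \<bullet> u)"
  have "c * (c * (u \<bullet> u)) = 1" using pos unfolding c_def by (simp add: field_simps)
  then have "(c \<cdot>\<^sub>v u) \<bullet> (c \<cdot>\<^sub>v u) = 1" using u(1) by simp
  moreover have "A *\<^sub>v (c \<cdot>\<^sub>v u) = e \<cdot>\<^sub>v (c \<cdot>\<^sub>v u)"
    using A u(1,3) by (simp add: mult_mat_vec smult_smult_assoc mult.commute)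
  ultimately show ?thesis using that[of "c \<cdot>\<^sub>v u"] u(1) by simp
qed

text \<open>Deflation, by induction on the list of roots. A reflection taking the first unit vector
  to a unit eigenvector for \<open>e\<close> conjugates \<open>A\<close> into a block matrix with
  \<open>e\<close> in the corner; the remaining block is symmetric and has the remaining roots. The
  diagonal keeps the order of \<open>es\<close>.\<close>

lemma orthogonal_diagonalization:
  fixes A :: "real mat"
  assumes "A \<in> carrier_mat n n" and "transpose_mat A = A"
    and "char_poly A = (\<Prod>e\<leftarrow>es. [:- e, 1:])"
  shows "\<exists>P \<in> carrier_mat n n. transpose_mat P * P = 1\<^sub>m n \<and>
    transpose_mat P * A * P = mat_diag n (\<lambda>i. es ! i)"
  using assms
proof (induction es arbitrary: n A)
  case Nil
  then have "n = 0" using degree_monic_char_poly[of A n] by simp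
  \<comment> \<open>In dimension 0 there is only one matrix, so \<open>A\<close> itself serves as
    the orthogonal matrix.\<close>
  with Nil show ?case by (intro bexI[of _ A]) (auto simp: mat_diag_def intro!: eq_matI)
next
  case (Cons e es n A)
  note A = Cons.prems(1)
  have mon: "monic (\<Prod>e\<leftarrow>es. [:- e, 1:])" by (rule monic_prod_list) auto
  have "degree (char_poly A) = Suc (degree (\<Prod>e\<leftarrow>es. [:- e, 1:]))"
    unfolding Cons.prems(3) list.map prod_list.Cons using mon by (subst degree_mult_eq) auto
  then obtain k where n: "n = Suc k" using degree_monic_char_poly[OF A] by simp
  have "poly (char_poly A) e = 0" unfolding Cons.prems(3) by simp
  then obtain v where v: "v \<in> carrier_vec n" "v \<bullet> v = 1" "A *\<^sub>v v = e \<cdot>\<^sub>v v"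
    using ex_unit_eigenvector[OF A] by blast
  obtain H where H: "H \<in> carrier_mat n n" and sH: "transpose_mat H = H"
    and HH: "H * H = 1\<^sub>m n" and Hv: "col H 0 = v"
    using ex_householder[OF v(1) _ v(2)] n by blast
  define B where "B = H * A * H"
  have B: "B \<in> carrier_mat n n" unfolding B_def using H A by simp
  have sB: "transpose_mat B = B"
    unfolding B_def using H A
    by (simp add: transpose_mult[of _ n n _ n] sH Cons.prems(2))
  have symB: "B $$ (i, j) = B $$ (j, i)" if "i < n" "j < n" for i j
    using that B arg_cong[OF sB, of "\<lambda>C. C $$ (i, j)"] by simp
  \<comment> \<open>Since \<open>H\<close> is an involution, it also takes \<open>v\<close> back to
    the first unit vector.\<close>
  have "H *\<^sub>v v = col (H * H) 0" using Hv H n by (subst col_mult2[of _ n n _ n]) auto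
  then have Hv': "H *\<^sub>v v = unit_vec n 0" using n by (simp add: HH)
  have "col B 0 = H *\<^sub>v (A *\<^sub>v v)"
    unfolding B_def using H A n v(1)
    by (subst col_mult2[of _ n n _ n]) (auto simp: Hv assoc_mult_mat_vec[of _ n n _ n])
  also have "\<dots> = e \<cdot>\<^sub>v unit_vec n 0" using H v(1) by (simp add: v(3) mult_mat_vec Hv')
  finally have colB: "col B 0 = e \<cdot>\<^sub>v unit_vec n 0" .
  have B0: "B $$ (i, 0) = (if i = 0 then e else 0)" if "i < n" for i
  proof -
    have "B $$ (i, 0) = col B 0 $ i" using that B n by simp
    also have "\<dots> = (if i = 0 then e else 0)" unfolding colB using that n by simp
    finally show ?thesis .
  qed
  define C where "C = mat k k (\<lambda>(i, j). B $$ (Suc i, Suc j))"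
  define E where "E = mat 1 1 (\<lambda>_. e)"
  have C: "C \<in> carrier_mat k k" and E: "E \<in> carrier_mat 1 1" unfolding C_def E_def by auto
  \<comment> \<open>The first column is known from \<open>B0\<close>; symmetry of \<open>B\<close>
    gives the first row.\<close>
  have Bblock: "B = four_block_mat E (0\<^sub>m 1 k) (0\<^sub>m k 1) C"
  proof (rule eq_matI)
    fix i j
    assume ij: "i < dim_row (four_block_mat E (0\<^sub>m 1 k) (0\<^sub>m k 1) C)"
      "j < dim_col (four_block_mat E (0\<^sub>m 1 k) (0\<^sub>m k 1) C)"
    then show "B $$ (i, j) = four_block_mat E (0\<^sub>m 1 k) (0\<^sub>m k 1) C $$ (i, j)"
      using B0[of i] B0[of j] symB[of 0 j] n C E by (auto simp: C_def E_def)
  qed (use B C E n in auto)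
  have sC: "transpose_mat C = C" unfolding C_def
    by (rule eq_matI) (use symB n in auto)
  \<comment> \<open>\<open>H\<close> is its own inverse, so \<open>A\<close> and \<open>B\<close>
    share their characteristic polynomial; cancelling the factor of \<open>e\<close> leaves that of
    \<open>C\<close>.\<close>
  have "similar_mat A B"
    unfolding similar_mat_def
  proof (intro exI)
    show "similar_mat_wit A B H H"
    proof (rule similar_mat_witI[of _ _ n])
      have "H * B * H = (H * H) * A * (H * H)" unfolding B_def using H A
        by (simp add: assoc_mult_mat[of _ n n _ n _ n])
      then show "A = H * B * H" unfolding HH using A by simp
    qed (use A B H HH in auto)
  qed
  then have "char_poly A = char_poly E * char_poly C"
    using char_poly_similar char_poly_four_block_zeros_col[OF E _ C] Bblock by force
  moreover have "char_poly E = [:- e, 1:]"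
    by (simp add: E_def char_poly_defs det_def sign_def)
  ultimately have "char_poly C = (\<Prod>e\<leftarrow>es. [:- e, 1:])"
    using Cons.prems(3) by (metis (no_types, lifting) list.map(2) mult_cancel_left pCons_eq_0_iff prod_list.Cons zero_neq_one)
  then obtain Q where Q: "Q \<in> carrier_mat k k" and QQ: "transpose_mat Q * Q = 1\<^sub>m k"
    and QC: "transpose_mat Q * C * Q = mat_diag k (\<lambda>i. es ! i)"
    using Cons.IH[OF C sC] by blast
  \<comment> \<open>\<open>Q\<close> diagonalizes the block \<open>C\<close>; extended by a 1 in the
    corner it diagonalizes \<open>B\<close>, so \<open>H * F\<close> is the orthogonal matrix for
    \<open>A\<close>.\<close>
  define F where "F = four_block_mat (1\<^sub>m 1) (0\<^sub>m 1 k) (0\<^sub>m k 1) Q"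
  have F: "F \<in> carrier_mat n n" unfolding F_def using Q n by auto
  have tF: "transpose_mat F = four_block_mat (1\<^sub>m 1) (0\<^sub>m 1 k) (0\<^sub>m k 1) (transpose_mat Q)"
    unfolding F_def using Q by (subst transpose_four_block_mat[of _ 1 1 _ k _ k]) auto
  have tFF: "transpose_mat F * F = 1\<^sub>m n"
    unfolding tF unfolding F_def using Q n
    by (subst mult_four_block_mat[of _ 1 1 _ k _ k _ _ 1 _ k]) (auto simp: QQ)
  have "transpose_mat F * B = four_block_mat E (0\<^sub>m 1 k) (0\<^sub>m k 1) (transpose_mat Q * C)"
    unfolding tF Bblock using Q C E
    by (subst mult_four_block_mat[of _ 1 1 _ k _ k _ _ 1 _ k]) auto
  then have "transpose_mat F * B * F = four_block_mat E (0\<^sub>m 1 k) (0\<^sub>m k 1) (mat_diag k (\<lambda>i. es ! i))"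
    unfolding F_def using Q C E
    by (simp, subst mult_four_block_mat[of _ 1 1 _ k _ k _ _ 1 _ k]) (auto simp: QC)
  also have "\<dots> = mat_diag n (\<lambda>i. (e # es) ! i)"
    unfolding E_def n by (rule eq_matI) (auto simp: mat_diag_def)
  finally have FBF: "transpose_mat F * B * F = mat_diag n (\<lambda>i. (e # es) ! i)" .
  have tHF: "transpose_mat (H * F) = transpose_mat F * H"
    using H F by (simp add: transpose_mult[of _ n n _ n] sH)
  show ?case
  proof (intro bexI conjI)
    show HF: "H * F \<in> carrier_mat n n" using H F by simp
    have "transpose_mat (H * F) * (H * F) = transpose_mat F * (H * H) * F"
      unfolding tHF using H F
      by (simp add: assoc_mult_mat[of _ n n _ n _ n])
    then show "transpose_mat (H * F) * (H * F) = 1\<^sub>m n" using F by (simp add: HH tFF)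
    have "transpose_mat (H * F) * A * (H * F) = transpose_mat F * B * F"
      unfolding tHF B_def using H F A
      by (simp add: assoc_mult_mat[of _ n n _ n _ n])
    then show "transpose_mat (H * F) * A * (H * F) = mat_diag n (\<lambda>i. (e # es) ! i)"
      unfolding FBF .
  qed
qed

section \<open>Rayleigh quotients and the two largest and two smallest eigenvalues\<close>

text \<open>\<open>C\<close> is the transpose of the diagonalizing orthogonal matrix, so
  \<open>C *\<^sub>v z\<close> lists the coordinates of \<open>z\<close> in an orthonormal
  eigenbasis, in decreasing order of the eigenvalues.\<close>

lemma ex_spectral_coordinates:
  assumes A: "A \<in> carrier_mat m m" and sym: "transpose_mat A = A"
  obtains C where "C \<in> carrier_mat m m"
    and "\<And>z. z \<in> carrier_vec m \<Longrightarrow> z \<bullet> z = (\<Sum>i<m. ((C *\<^sub>v z) $ i)\<^sup>2)"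
    and "\<And>z. z \<in> carrier_vec m \<Longrightarrow>
      z \<bullet> (A *\<^sub>v z) = (\<Sum>i<m. eigvals_desc A ! i * ((C *\<^sub>v z) $ i)\<^sup>2)"
proof -
  let ?D = "mat_diag m (\<lambda>i. eigvals_desc A ! i)"
  obtain P where P: "P \<in> carrier_mat m m" and PP: "transpose_mat P * P = 1\<^sub>m m"
    and PA: "transpose_mat P * A * P = ?D"
    using orthogonal_diagonalization[OF A sym char_poly_eigvals_desc[OF A sym]] by blast
  let ?C = "transpose_mat P"
  have C: "?C \<in> carrier_mat m m" using P by simp
  have PP': "P * ?C = 1\<^sub>m m" using mat_mult_left_right_inverse[OF C P PP] .
  have "P * ?D * ?C = (P * ?C) * A * (P * ?C)" unfolding PA[symmetric] using A P C
    by (simp add: assoc_mult_mat[of _ m m _ m _ m])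
  then have A_eq: "A = P * ?D * ?C" unfolding PP' using A by simp
  have tr: "z \<bullet> (P *\<^sub>v y) = (?C *\<^sub>v z) \<bullet> y" if "z \<in> carrier_vec m" "y \<in> carrier_vec m" for y z
    using transpose_vec_mult_scalar[OF P that(2,1)] by simp
  show ?thesis
  proof
    show "?C \<in> carrier_mat m m" by (rule C)
    fix z :: "real vec" assume z: "z \<in> carrier_vec m"
    define y where "y = ?C *\<^sub>v z"
    have y: "y \<in> carrier_vec m" unfolding y_def using C z by simp
    have "z = P *\<^sub>v y"
      unfolding y_def using P C z by (simp add: PP' flip: assoc_mult_mat_vec[of _ m m _ m])
    then have "z \<bullet> z = y \<bullet> y" using tr[OF z y] unfolding y_def by simp
    then show "z \<bullet> z = (\<Sum>i<m. ((?C *\<^sub>v z) $ i)\<^sup>2)"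
      using y unfolding y_def[symmetric]
      by (simp add: scalar_prod_def atLeast0LessThan power2_eq_square)
    have Dy: "?D *\<^sub>v y = vec m (\<lambda>i. eigvals_desc A ! i * y $ i)"
    proof (rule eq_vecI)
      fix i assume "i < dim_vec (vec m (\<lambda>i. eigvals_desc A ! i * y $ i))"
      then have i: "i < m" by simp
      have "(?D *\<^sub>v y) $ i = (\<Sum>j<m. (if i = j then eigvals_desc A ! j else 0) * y $ j)"
        using i y by (simp add: mat_diag_def scalar_prod_def atLeast0LessThan)
      also have "\<dots> = (\<Sum>j<m. if i = j then eigvals_desc A ! j * y $ j else 0)"
        by (intro sum.cong) auto
      finally show "(?D *\<^sub>v y) $ i = vec m (\<lambda>i. eigvals_desc A ! i * y $ i) $ i"
        using i by simp
    qed (simp add: mat_diag_def)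
    have "A *\<^sub>v z = P *\<^sub>v (?D *\<^sub>v y)"
      unfolding y_def using P C z by (subst A_eq) (simp add: assoc_mult_mat_vec[of _ m m _ m])
    then have "z \<bullet> (A *\<^sub>v z) = y \<bullet> (?D *\<^sub>v y)"
      using tr[OF z, of "?D *\<^sub>v y"] y unfolding y_def[symmetric] by (simp add: Dy)
    then show "z \<bullet> (A *\<^sub>v z) = (\<Sum>i<m. eigvals_desc A ! i * ((?C *\<^sub>v z) $ i)\<^sup>2)"
      unfolding y_def[symmetric] Dy using y
      by (simp add: scalar_prod_def atLeast0LessThan power2_eq_square mult_ac)
  qed
qed

text \<open>In spectral coordinates the bound holds term by term, as every weight is at most the
  first one.\<close>

lemma quadratic_form_le_eigval_first:
  assumes A: "A \<in> carrier_mat m m" and sym: "transpose_mat A = A" and z: "z \<in> carrier_vec m"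
  shows "z \<bullet> (A *\<^sub>v z) \<le> eigval A 1 * (z \<bullet> z)"
proof -
  obtain C where C: "\<And>z. z \<in> carrier_vec m \<Longrightarrow> z \<bullet> z = (\<Sum>i<m. ((C *\<^sub>v z) $ i)\<^sup>2)"
    "\<And>z. z \<in> carrier_vec m \<Longrightarrow> z \<bullet> (A *\<^sub>v z) = (\<Sum>i<m. eigvals_desc A ! i * ((C *\<^sub>v z) $ i)\<^sup>2)"
    using ex_spectral_coordinates[OF A sym] by metis
  show ?thesis
    unfolding C(1)[OF z] C(2)[OF z] sum_distrib_left eigval_def
    by (intro sum_mono mult_right_mono eigvals_desc_mono)
      (auto simp: length_eigvals_desc[OF A sym])
qed

lemma eigval_last_le_quadratic_form:
  assumes A: "A \<in> carrier_mat m m" and sym: "transpose_mat A = A" and z: "z \<in> carrier_vec m"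
  shows "eigval A m * (z \<bullet> z) \<le> z \<bullet> (A *\<^sub>v z)"
proof -
  obtain C where C: "\<And>z. z \<in> carrier_vec m \<Longrightarrow> z \<bullet> z = (\<Sum>i<m. ((C *\<^sub>v z) $ i)\<^sup>2)"
    "\<And>z. z \<in> carrier_vec m \<Longrightarrow> z \<bullet> (A *\<^sub>v z) = (\<Sum>i<m. eigvals_desc A ! i * ((C *\<^sub>v z) $ i)\<^sup>2)"
    using ex_spectral_coordinates[OF A sym] by metis
  show ?thesis
    unfolding C(1)[OF z] C(2)[OF z] sum_distrib_left eigval_def
    by (intro sum_mono mult_right_mono eigvals_desc_mono)
      (auto simp: length_eigvals_desc[OF A sym])
qed

text \<open>One homogeneous linear equation in two unknowns has a nontrivial solution. It yields a
  vector of the plane orthogonal to a chosen eigenvector.\<close>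

lemma ex_combination_coordinate_zero:
  fixes C :: "real mat"
  assumes C: "C \<in> carrier_mat m m" and u: "u \<in> carrier_vec m" and w: "w \<in> carrier_vec m"
    and i: "i < m"
  obtains a b where "a \<noteq> 0 \<or> b \<noteq> 0" "(C *\<^sub>v (a \<cdot>\<^sub>v u + b \<cdot>\<^sub>v w)) $ i = 0"
proof -
  have lin: "(C *\<^sub>v (a \<cdot>\<^sub>v u + b \<cdot>\<^sub>v w)) $ i = a * (C *\<^sub>v u) $ i + b * (C *\<^sub>v w) $ i" for a b
    using C u w i by (simp add: scalar_prod_add_distrib[of _ m])
  show ?thesis
  proof (cases "(C *\<^sub>v u) $ i = 0")
    case True
    then show ?thesis using that[of 1 0] lin[of 1 0] by simp
  next
    case False
    then show ?thesis
      using that[of "- (C *\<^sub>v w) $ i" "(C *\<^sub>v u) $ i"] lin[of "- (C *\<^sub>v w) $ i" "(C *\<^sub>v u) $ i"] by simp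
  qed
qed

text \<open>One direction of the Courant-Fischer principle. The plane spanned by \<open>u\<close>
  and \<open>w\<close> contains a nonzero vector without component along the first eigenvector; its
  Rayleigh quotient is at least \<open>t\<close> and at most the second eigenvalue. Assumption
  \<open>pos\<close> expresses linear independence of \<open>u\<close> and \<open>w\<close>.\<close>

lemma le_eigval_second:
  assumes A: "A \<in> carrier_mat m m" and sym: "transpose_mat A = A" and m: "2 \<le> m"
    and u: "u \<in> carrier_vec m" and w: "w \<in> carrier_vec m"
    and pos: "\<And>a b z. z = a \<cdot>\<^sub>v u + b \<cdot>\<^sub>v w \<Longrightarrow> a \<noteq> 0 \<or> b \<noteq> 0 \<Longrightarrow> 0 < z \<bullet> z"
    and le: "\<And>a b z. z = a \<cdot>\<^sub>v u + b \<cdot>\<^sub>v w \<Longrightarrow> t * (z \<bullet> z) \<le> z \<bullet> (A *\<^sub>v z)"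
  shows "t \<le> eigval A 2"
proof -
  obtain C where C: "C \<in> carrier_mat m m"
    "\<And>z. z \<in> carrier_vec m \<Longrightarrow> z \<bullet> z = (\<Sum>i<m. ((C *\<^sub>v z) $ i)\<^sup>2)"
    "\<And>z. z \<in> carrier_vec m \<Longrightarrow> z \<bullet> (A *\<^sub>v z) = (\<Sum>i<m. eigvals_desc A ! i * ((C *\<^sub>v z) $ i)\<^sup>2)"
    using ex_spectral_coordinates[OF A sym] by metis
  obtain a b where ab: "a \<noteq> 0 \<or> b \<noteq> 0" "(C *\<^sub>v (a \<cdot>\<^sub>v u + b \<cdot>\<^sub>v w)) $ 0 = 0"
    using ex_combination_coordinate_zero[OF C(1) u w, of 0] m by auto
  define z where "z = a \<cdot>\<^sub>v u + b \<cdot>\<^sub>v w"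
  have z: "z \<in> carrier_vec m" unfolding z_def using u w by simp
  have "z \<bullet> (A *\<^sub>v z) \<le> eigval A 2 * (z \<bullet> z)"
    unfolding C(2)[OF z] C(3)[OF z] sum_distrib_left
  proof (rule sum_mono)
    fix i assume i: "i \<in> {..<m}"
    show "eigvals_desc A ! i * ((C *\<^sub>v z) $ i)\<^sup>2 \<le> eigval A 2 * ((C *\<^sub>v z) $ i)\<^sup>2"
    \<comment> \<open>The term at 0 vanishes by the choice of \<open>z\<close>; all later weights
      are at most the one at index 1, which is \<open>eigval A 2\<close>.\<close>
    proof (cases "i = 0")
      case True
      then show ?thesis using ab(2) unfolding z_def by simp
    next
      case False
      with i show ?thesis unfolding eigval_def
        by (intro mult_right_mono eigvals_desc_mono) (auto simp: length_eigvals_desc[OF A sym])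
    qed
  qed
  with le[OF z_def] have "t * (z \<bullet> z) \<le> eigval A 2 * (z \<bullet> z)" by linarith
  with pos[OF z_def ab(1)] show ?thesis by simp
qed

text \<open>The dual argument: the vector chosen in the plane has no component along the last
  eigenvector.\<close>

lemma eigval_penultimate_le:
  assumes A: "A \<in> carrier_mat m m" and sym: "transpose_mat A = A" and m: "2 \<le> m"
    and u: "u \<in> carrier_vec m" and w: "w \<in> carrier_vec m"
    and pos: "\<And>a b z. z = a \<cdot>\<^sub>v u + b \<cdot>\<^sub>v w \<Longrightarrow> a \<noteq> 0 \<or> b \<noteq> 0 \<Longrightarrow> 0 < z \<bullet> z"
    and le: "\<And>a b z. z = a \<cdot>\<^sub>v u + b \<cdot>\<^sub>v w \<Longrightarrow> z \<bullet> (A *\<^sub>v z) \<le> t * (z \<bullet> z)"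
  shows "eigval A (m - 1) \<le> t"
proof -
  obtain C where C: "C \<in> carrier_mat m m"
    "\<And>z. z \<in> carrier_vec m \<Longrightarrow> z \<bullet> z = (\<Sum>i<m. ((C *\<^sub>v z) $ i)\<^sup>2)"
    "\<And>z. z \<in> carrier_vec m \<Longrightarrow> z \<bullet> (A *\<^sub>v z) = (\<Sum>i<m. eigvals_desc A ! i * ((C *\<^sub>v z) $ i)\<^sup>2)"
    using ex_spectral_coordinates[OF A sym] by metis
  obtain a b where ab: "a \<noteq> 0 \<or> b \<noteq> 0" "(C *\<^sub>v (a \<cdot>\<^sub>v u + b \<cdot>\<^sub>v w)) $ (m - 1) = 0"
    using ex_combination_coordinate_zero[OF C(1) u w, of "m - 1"] m by auto
  define z where "z = a \<cdot>\<^sub>v u + b \<cdot>\<^sub>v w"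
  have z: "z \<in> carrier_vec m" unfolding z_def using u w by simp
  have "eigval A (m - 1) * (z \<bullet> z) \<le> z \<bullet> (A *\<^sub>v z)"
    unfolding C(2)[OF z] C(3)[OF z] sum_distrib_left
  proof (rule sum_mono)
    fix i assume i: "i \<in> {..<m}"
    show "eigval A (m - 1) * ((C *\<^sub>v z) $ i)\<^sup>2 \<le> eigvals_desc A ! i * ((C *\<^sub>v z) $ i)\<^sup>2"
    \<comment> \<open>\<open>eigval A (m - 1)\<close> sits at index \<open>m - 2\<close>, so it
      bounds from below every weight except the last, whose term vanishes.\<close>
    proof (cases "i = m - 1")
      case True
      then show ?thesis using ab(2) unfolding z_def by simp
    next
      case False
      with i m show ?thesis unfolding eigval_def
        by (intro mult_right_mono eigvals_desc_mono) (auto simp: length_eigvals_desc[OF A sym])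
    qed
  qed
  with le[OF z_def] have "eigval A (m - 1) * (z \<bullet> z) \<le> t * (z \<bullet> z)" by linarith
  with pos[OF z_def ab(1)] show ?thesis by simp
qed

section \<open>Double counting of edges and arcs\<close>

lemma sum_lessThan_split:
  fixes f :: "nat \<Rightarrow> 'b :: comm_monoid_add"
  shows "(\<Sum>i<m + n. f i) = (\<Sum>i<m. f i) + (\<Sum>i<n. f (m + i))"
  by (induction n) (simp_all add: add.assoc)

lemma size_edges: "size (edges G) = num_edges G + num_loops G"
  unfolding num_edges_def num_loops_def by (metis multiset_partition size_union)

lemma sum_count_arcs:
  assumes "finite V" "\<forall>(u, v) \<in># M. u \<in> V \<and> v \<in> V"
  shows "(\<Sum>u\<in>V. \<Sum>v\<in>V. count M (u, v)) = size M"
proof -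
  have "set_mset M \<subseteq> V \<times> V" using assms(2) by auto
  then have "size M = (\<Sum>a\<in>V \<times> V. count M a)"
    unfolding size_multiset_overloaded_eq using assms(1)
    by (intro sum.mono_neutral_left) (auto simp: not_in_iff)
  then show ?thesis by (simp add: sum.cartesian_product)
qed

lemma sum_size_filter_eq:
  assumes "finite V" "\<forall>a \<in># M. f a \<in> V"
  shows "(\<Sum>v\<in>V. size {#a \<in># M. f a = v#}) = size M"
  using assms(2)
proof (induction M)
  case (add a M)
  have "(\<Sum>v\<in>V. size {#b \<in># add_mset a M. f b = v#}) =
      (\<Sum>v\<in>V. size {#b \<in># M. f b = v#} + (if f a = v then 1 else 0))"
    by (intro sum.cong) auto
  then show ?case using add assms(1) by (simp add: sum.distrib)
qed simp

text \<open>The summands are the entries of the edge matrix. A proper edge is counted at two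
  symmetric positions and a loop at one diagonal position with weight 2, so each element of
  \<open>M\<close> contributes 2.\<close>

lemma sum_edge_multiplicities:
  assumes "finite V" "\<forall>e \<in># M. set_uprod e \<subseteq> V"
  shows "(\<Sum>u\<in>V. \<Sum>v\<in>V. (if u = v then 2 else 1) * count M (Upair u v)) = 2 * size M"
  using assms(2)
proof (induction M)
  case (add e M)
  obtain a b where e: "e = Upair a b" by (cases e)
  have ab: "a \<in> V" "b \<in> V" using add.prems unfolding e by auto
  have single: "(\<Sum>u\<in>V. \<Sum>v\<in>V. if u = x then if v = y then 1 else 0 else 0) = (1 :: nat)"
    if "x \<in> V" "y \<in> V" for x y
  proof -
    have "(\<Sum>v\<in>V. if u = x then if v = y then 1 else 0 else 0) = (if u = x then 1 else (0 :: nat))" for u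
      using that assms(1) by simp
    then show ?thesis using that assms(1) by simp
  qed
  \<comment> \<open>The contribution of the new edge is written as two indicators, at
    \<open>(a, b)\<close> and \<open>(b, a)\<close>; for a loop they coincide and add up to the
    diagonal weight.\<close>
  have "(\<Sum>u\<in>V. \<Sum>v\<in>V. (if u = v then 2 else 1) * count (add_mset e M) (Upair u v)) =
      (\<Sum>u\<in>V. \<Sum>v\<in>V. (if u = v then 2 else 1) * count M (Upair u v) +
        ((if u = a then if v = b then 1 else 0 else 0) +
         (if u = b then if v = a then 1 else 0 else 0)))"
    unfolding e by (intro sum.cong refl) auto
  also have "\<dots> = 2 * size M + (1 + 1)"
    using add unfolding sum.distrib by (simp add: single[OF ab] single[OF ab(2,1)])
  finally show ?case by simp
qed simp

text \<open>The handshake lemma: each edge counts once at both ends, and the second summand of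
  \<open>deg\<close> supplies the second count of a loop.\<close>

lemma sum_deg:
  assumes "finite V" "\<forall>e \<in># edges G. set_uprod e \<subseteq> V"
  shows "(\<Sum>v\<in>V. deg G v) = 2 * size (edges G)"
proof -
  have "(\<Sum>v\<in>V. size {#e \<in># M. v \<in> set_uprod e#} + count M (Upair v v)) = 2 * size M"
    if "\<forall>e \<in># M. set_uprod e \<subseteq> V" for M :: "'a uprod multiset"
    using that
  proof (induction M)
    case (add e M)
    obtain a b where e: "e = Upair a b" by (cases e)
    have ab: "a \<in> V" "b \<in> V" using add.prems unfolding e by auto
    have "(\<Sum>v\<in>V. size {#x \<in># add_mset e M. v \<in> set_uprod x#} + count (add_mset e M) (Upair v v)) =
        (\<Sum>v\<in>V. (size {#x \<in># M. v \<in> set_uprod x#} + count M (Upair v v)) +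
          ((if v = a then 1 else 0) + (if v = b then 1 else 0)))"
      unfolding e by (intro sum.cong refl) auto
    also have "\<dots> = 2 * size M + 2"
      using add ab assms(1) unfolding sum.distrib by simp
    finally show ?case by simp
  qed simp
  from this[OF assms(2)] show ?thesis unfolding deg_def .
qed

section \<open>The quadratic form on block-constant vectors and the four bounds\<close>

text \<open>On such a vector only the sums of the entries of the four blocks matter. Each
  off-diagonal block sums to the number of arcs. In a diagonal block the edge matrix and the degrees
  each contribute twice the number of edges and loops, and the out- or in-degrees contribute the
  number of arcs.\<close>

lemma quadratic_form_block_constant:
  fixes G :: "'a mixed_graph" and p q :: real
  assumes wf: "wf_mixed_graph G" and vs: "distinct vs" "set vs = verts G" and n: "length vs = n"
  defines "z \<equiv> vec (2 * n) (\<lambda>i. if i < n then p else q)"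
  shows "z \<bullet> (integrated_signless_laplacian G vs *\<^sub>v z) =
    4 * (real (num_edges G) + real (num_loops G)) * (p\<^sup>2 + q\<^sup>2) + real (num_arcs G) * (p + q)\<^sup>2"
proof -
  let ?Q = "integrated_signless_laplacian G vs" and ?V = "verts G"
  let ?M = "\<lambda>u v. (if u = v then 2 else 1) * real (count (edges G) (Upair u v))"
  have fin: "finite ?V" and E: "\<forall>e \<in># edges G. set_uprod e \<subseteq> ?V"
    and Arcs: "\<forall>(u, v) \<in># arcs G. u \<in> ?V \<and> v \<in> ?V"
    using wf unfolding wf_mixed_graph_def by auto
  then have ends: "\<forall>a \<in># arcs G. fst a \<in> ?V" "\<forall>a \<in># arcs G. snd a \<in> ?V" by auto
  have nth: "(\<Sum>i<n. f (vs ! i)) = (\<Sum>v\<in>?V. f v)" for f :: "'a \<Rightarrow> nat"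
    using sum.reindex_bij_betw[OF bij_betw_nth[OF vs(1) refl vs(2)[symmetric]]] n by simp
  have nth2: "(\<Sum>i<n. \<Sum>j<n. f (vs ! i) (vs ! j)) = (\<Sum>u\<in>?V. \<Sum>v\<in>?V. f u v)"
    for f :: "'a \<Rightarrow> 'a \<Rightarrow> nat"
    unfolding nth by (rule nth)
  have nth_eq: "vs ! i = vs ! j \<longleftrightarrow> i = j" if "i < n" "j < n" for i j
    using that vs(1) n by (simp add: nth_eq_iff_index_eq)
  have entries:
    "?Q $$ (i, j) = ?M (vs ! i) (vs ! j) +
       (if i = j then real (deg G (vs ! i) + out_deg G (vs ! i)) else 0)"
    "?Q $$ (i, n + j) = real (count (arcs G) (vs ! i, vs ! j))"
    "?Q $$ (n + i, j) = real (count (arcs G) (vs ! j, vs ! i))"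
    "?Q $$ (n + i, n + j) = ?M (vs ! i) (vs ! j) +
       (if i = j then real (deg G (vs ! i) + in_deg G (vs ! i)) else 0)"
    if "i < n" "j < n" for i j
    using that nth_eq[OF that] n
    unfolding integrated_signless_laplacian_def integrated_degree_def integrated_adjacency_def
      edge_matrix_def arc_matrix_def mat_diag_def Let_def
    by auto
  have arcs: "(\<Sum>i<n. \<Sum>j<n. real (count (arcs G) (vs ! i, vs ! j))) = num_arcs G"
    using sum_count_arcs[OF fin Arcs] nth2[of "\<lambda>u v. count (arcs G) (u, v)"]
    unfolding num_arcs_def by (simp flip: of_nat_sum)
  have "(\<Sum>i<n. \<Sum>j<n. real (count (arcs G) (vs ! j, vs ! i))) = num_arcs G"
    unfolding arcs[symmetric] by (rule sum.swap)
  note arcs = arcs this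
  have "(\<Sum>i<n. \<Sum>j<n. ?M (vs ! i) (vs ! j)) = real (\<Sum>i<n. \<Sum>j<n.
      (if vs ! i = vs ! j then 2 else 1) * count (edges G) (Upair (vs ! i) (vs ! j)))"
    unfolding of_nat_sum by (intro sum.cong refl) simp
  then have M: "(\<Sum>i<n. \<Sum>j<n. ?M (vs ! i) (vs ! j)) = 2 * real (size (edges G))"
    using sum_edge_multiplicities[OF fin E]
      nth2[of "\<lambda>u v. (if u = v then 2 else 1) * count (edges G) (Upair u v)"] by linarith
  have deg: "(\<Sum>i<n. real (deg G (vs ! i))) = 2 * real (size (edges G))"
    using sum_deg[OF fin E] nth[of "deg G"] by (simp flip: of_nat_sum)
  have out_deg: "(\<Sum>i<n. real (out_deg G (vs ! i))) = real (num_arcs G)"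
    using sum_size_filter_eq[OF fin, of "arcs G" fst] ends nth[of "out_deg G"]
    unfolding out_deg_def num_arcs_def by (simp flip: of_nat_sum)
  have in_deg: "(\<Sum>i<n. real (in_deg G (vs ! i))) = real (num_arcs G)"
    using sum_size_filter_eq[OF fin, of "arcs G" snd] ends nth[of "in_deg G"]
    unfolding in_deg_def num_arcs_def by (simp flip: of_nat_sum)
  have Q: "?Q \<in> carrier_mat (n + n) (n + n)"
    using integrated_signless_laplacian_carrier[of G vs] n by (simp add: mult_2)
  let ?S = "\<lambda>k l. \<Sum>i<n. \<Sum>j<n. ?Q $$ (k + i, l + j)"
  have "z \<bullet> (?Q *\<^sub>v z) = (\<Sum>i<n + n. \<Sum>j<n + n. z $ i * (?Q $$ (i, j) * z $ j))"
    using Q unfolding z_def mult_2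
    by (simp add: scalar_prod_def atLeast0LessThan sum_distrib_left)
  \<comment> \<open>Splitting both index ranges at \<open>n\<close> makes \<open>z\<close> constant
    on each part.\<close>
  also have "\<dots> = p\<^sup>2 * ?S 0 0 + p * q * ?S 0 n + q * p * ?S n 0 + q\<^sup>2 * ?S n n"
    unfolding sum_lessThan_split sum.distrib z_def
    by (simp add: sum_distrib_left power2_eq_square mult_ac)
  also have "?S 0 0 = 4 * real (size (edges G)) + num_arcs G"
    by (simp add: entries sum.distrib M deg out_deg)
  also have "?S n n = 4 * real (size (edges G)) + num_arcs G"
    by (simp add: entries sum.distrib M deg in_deg)
  also have "?S 0 n = num_arcs G" by (simp add: entries arcs)
  also have "?S n 0 = num_arcs G" by (simp add: entries arcs)
  finally show ?thesis unfolding size_edges by (simp add: power2_eq_square algebra_simps)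
qed

theorem theorem4p16:
  fixes G :: "'a mixed_graph" and vs :: "'a list" and n :: nat and \<xi> :: "nat \<Rightarrow> real"
  assumes "wf_mixed_graph G"
    and "distinct vs" and "set vs = verts G" and "length vs = n" and "n \<ge> 1"
    and "\<xi> = eigval (integrated_signless_laplacian G vs)"
  shows "\<xi> (2 * n) \<le> 4 / real n * (real (num_edges G) + real (num_loops G)) \<and>
    4 / real n * (real (num_edges G) + real (num_loops G)) \<le> \<xi> 2 \<and>
    \<xi> (2 * n - 1) \<le> 2 / real n * (2 * real (num_edges G) + 2 * real (num_loops G) + real (num_arcs G)) \<and>
    2 / real n * (2 * real (num_edges G) + 2 * real (num_loops G) + real (num_arcs G)) \<le> \<xi> 1"
proof -
  let ?Q = "integrated_signless_laplacian G vs"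
  define z where "z p q = vec (2 * n) (\<lambda>i. if i < n then p else q :: real)" for p q
  define s where "s = real (num_edges G) + real (num_loops G)"
  define a where "a = real (num_arcs G)"
  have n: "real n > 0" using assms(5) by simp
  have Q: "?Q \<in> carrier_mat (2 * n) (2 * n)"
    using integrated_signless_laplacian_carrier[of G vs] assms(4) by simp
  note sym = transpose_integrated_signless_laplacian[of G vs]
  have z: "z p q \<in> carrier_vec (2 * n)" for p q unfolding z_def by simp
  have zQz: "z p q \<bullet> (?Q *\<^sub>v z p q) = 4 * s * (p\<^sup>2 + q\<^sup>2) + a * (p + q)\<^sup>2" for p q
    using quadratic_form_block_constant[OF assms(1-4)] unfolding z_def s_def a_def .
  have zz: "z p q \<bullet> z p q = real n * (p\<^sup>2 + q\<^sup>2)" for p q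
    unfolding z_def mult_2
    by (simp add: scalar_prod_def atLeast0LessThan sum_lessThan_split power2_eq_square algebra_simps)
  \<comment> \<open>\<open>z 1 0\<close> and \<open>z 0 1\<close> are the indicator vectors of the
    two copies of the vertex set; they span the plane.\<close>
  have comb: "p \<cdot>\<^sub>v z 1 0 + q \<cdot>\<^sub>v z 0 1 = z p q" for p q
    unfolding z_def by (rule eq_vecI) auto
  have pos: "0 < y \<bullet> y" if "y = p \<cdot>\<^sub>v z 1 0 + q \<cdot>\<^sub>v z 0 1" "p \<noteq> 0 \<or> q \<noteq> 0" for p q y
  proof -
    have "y \<bullet> y = real n * (p\<^sup>2 + q\<^sup>2)" unfolding that(1) comb zz ..
    then show ?thesis using that(2) n by (simp add: sum_power2_gt_zero_iff)
  qed
  have "4 / real n * s \<le> \<xi> 2"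
    unfolding assms(6)
  proof (rule le_eigval_second[OF Q sym _ z z pos])
    fix p q y assume "y = p \<cdot>\<^sub>v z 1 0 + q \<cdot>\<^sub>v z 0 1"
    \<comment> \<open>Dropping the nonnegative term \<open>a * (p + q)\<^sup>2\<close> leaves
      exactly the left-hand side.\<close>
    then show "4 / real n * s * (y \<bullet> y) \<le> y \<bullet> (?Q *\<^sub>v y)"
      using n by (simp add: comb zz zQz a_def)
  qed (use assms(5) in auto)
  moreover have "\<xi> (2 * n - 1) \<le> 2 / real n * (2 * s + a)"
    unfolding assms(6)
  proof (rule eigval_penultimate_le[OF Q sym _ z z pos])
    fix p q y assume y: "y = p \<cdot>\<^sub>v z 1 0 + q \<cdot>\<^sub>v z 0 1"
    \<comment> \<open>Equivalent to bounding \<open>a * (p + q)\<^sup>2\<close> by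
      \<open>2 * a * (p\<^sup>2 + q\<^sup>2)\<close>.\<close>
    have "0 \<le> a * (p - q)\<^sup>2" unfolding a_def by simp
    then have "4 * s * (p\<^sup>2 + q\<^sup>2) + a * (p + q)\<^sup>2 \<le> 2 * (2 * s + a) * (p\<^sup>2 + q\<^sup>2)"
      by (simp add: power2_eq_square algebra_simps)
    then show "y \<bullet> (?Q *\<^sub>v y) \<le> 2 / real n * (2 * s + a) * (y \<bullet> y)"
      using n by (simp add: y comb zz zQz)
  qed (use assms(5) in auto)
  moreover have "\<xi> (2 * n) \<le> 4 / real n * s"
    \<comment> \<open>Opposite signs on the two copies cancel the arc term: the form is
      \<open>8 * s\<close> and the squared norm \<open>2 * n\<close>.\<close>
    using eigval_last_le_quadratic_form[OF Q sym z, of 1 "-1"] n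
    unfolding assms(6) zz zQz by (simp add: field_simps)
  moreover have "2 / real n * (2 * s + a) \<le> \<xi> 1"
    \<comment> \<open>On the all-ones vector the form is \<open>8 * s + 4 * a\<close> and the
      squared norm \<open>2 * n\<close>.\<close>
    using quadratic_form_le_eigval_first[OF Q sym z, of 1 1] n
    unfolding assms(6) zz zQz by (simp add: field_simps)
  ultimately show ?thesis unfolding s_def a_def by (simp add: distrib_left)
qed

end
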